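(* Let $\alpha,\beta>0$ and $C\ge 1$. There exist constants $c>0$ and $C'>0$ depending only on $\alpha,\beta,C$ such that the following holds. Suppose $\mathcal{A}$ is a set of $n$ real numbers with $|\mathcal{A}+\mathcal{A}|\le n^{2-\alpha}$, $C^{-1}n^{2-\beta}\le|\mathcal{A}\mathcal{A}|\le C n^{2-\beta}$, and $|\mathcal{A}/\mathcal{A}|\le n^{2-\beta}$. Then there exist a set $\mathcal{B}$ of $N>n$ real numbers and a graph $G_N$ with vertex set $\mathcal{B}$ having at least $c\,N^{\frac{3}{3-\beta}}$ edges such that $$|\mathcal{B}/_{G_N}\mathcal{B}|\le C' N \quad\text{and}\quad |\mathcal{B}+_{G_N}\mathcal{B}|\le C' N^{\frac{2-\alpha}{3-\beta}}.$$
   Context: For a finite set $\mathcal{A}$ of reals, $\mathcal{A}+\mathcal{A}=\{a+b:a,b\in\mathcal{A}\}$, $\mathcal{A}\mathcal{A}=\{ab:a,b\in\mathcal{A}\}$ and $\mathcal{A}/\mathcal{A}=\{a/b:a,b\in\mathcal{A}\}$. For a graph $G$ whose vertices are the elements of a set $\mathcal{B}$, $\mathcal{B}+_{G}\mathcal{B}=\{a+b:\{a,b\}\in E(G)\}$ and $\mathcal{B}/_{G}\mathcal{B}=\{a/b:\{a,b\}\in E(G)\}$, where each edge $\{a,b\}$ contributes both ratios $a/b$ and $b/a$. *)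

theory Defs
  imports Complex_Main "HOL-Library.Set_Algebras"
begin

text \<open>Sums and products \<open>A + A\<close>, \<open>A * A\<close> of sets are those of \<open>Set_Algebras\<close>.
  In the ratio set, division by zero is left out rather than counted as the
  ratio \<open>0\<close> (HOL has \<open>x / 0 = 0\<close>); this only makes a difference for \<open>A = {0}\<close>.\<close>

definition ratio_set :: "real set \<Rightarrow> real set" where
  "ratio_set A = {a / b | a b. a \<in> A \<and> b \<in> A \<and> b \<noteq> 0}"

definition simple_graph :: "'a set \<Rightarrow> 'a set set \<Rightarrow> bool" where
  "simple_graph V E \<longleftrightarrow> E \<subseteq> {{u, v} | u v. u \<in> V \<and> v \<in> V \<and> u \<noteq> v}"

definition graph_sum_set :: "real set set \<Rightarrow> real set" where
  "graph_sum_set E = {a + b | a b. {a, b} \<in> E}"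

text \<open>As \<open>{a, b} = {b, a}\<close>, each edge contributes both \<open>a / b\<close> and \<open>b / a\<close>. The set is
  meaningful only for graphs without an edge at \<open>0\<close>.\<close>

definition graph_ratio_set :: "real set set \<Rightarrow> real set" where
  "graph_ratio_set E = {a / b | a b. {a, b} \<in> E}"

end

theory Submission
  imports Defs
begin

text \<open>For a parameter \<open>t\<close>, join \<open>a (1 - t c)\<close> to \<open>b + t a c\<close> for all \<open>a, b, c\<close> in \<open>A\<close> with
  \<open>a, c\<close> nonzero. The sum along such an edge is \<open>a + b\<close>, and the ratio
  \<open>(1 - t c) / (b / a + t c)\<close> depends only on \<open>b / a\<close> and \<open>c\<close>. There are at most
  \<open>n\<^sup>2 + n |AA|\<close> vertices. For all but finitely many \<open>t\<close> the map \<open>(a, c) \<mapsto> a (1 - t c)\<close>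
  is injective, so that an edge determines \<open>(a, b, c)\<close> up to the order of its endpoints, which
  gives about \<open>n\<^sup>3 / 2\<close> edges. If \<open>\<beta> > 1\<close> then \<open>|AA| \<ge> n - 1\<close> bounds \<open>n\<close>, and a
  single edge suffices.\<close>

section \<open>Counting unordered pairs and padding vertex sets\<close>

text \<open>Forgetting the order is at most two-to-one. After choosing one representative in
  \<open>S\<close> for each unordered pair, the representatives and their swaps cover
  \<open>S\<close>.\<close>

lemma card_le_twice_card_unordered_pairs:
  assumes "finite S"
  shows "card S \<le> 2 * card ((\<lambda>(x, y). {x, y}) ` S)"
proof -
  let ?f = "\<lambda>(x, y). {x, y}"
  let ?E = "?f ` S"
  let ?g = "inv_into S ?f"
  have sub: "S \<subseteq> ?g ` ?E \<union> prod.swap ` ?g ` ?E"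
  proof
    fix p assume p: "p \<in> S"
    obtain x y where xy: "p = (x, y)" by force
    obtain u v where uv: "?g (?f p) = (u, v)" by force
    have "?f (?g (?f p)) = ?f p"
      using p by (intro f_inv_into_f) auto
    then have "{u, v} = {x, y}" using uv xy by simp
    then have "p = (u, v) \<or> p = prod.swap (u, v)"
      unfolding xy by (auto simp: doubleton_eq_iff)
    then have "p = ?g (?f p) \<or> p = prod.swap (?g (?f p))" unfolding uv .
    then show "p \<in> ?g ` ?E \<union> prod.swap ` ?g ` ?E" using p by blast
  qed
  have fin: "finite ?E" using assms by simp
  have "card S \<le> card (?g ` ?E \<union> prod.swap ` ?g ` ?E)"
    using sub fin by (intro card_mono) auto
  also have "\<dots> \<le> card (?g ` ?E) + card (prod.swap ` ?g ` ?E)" by (rule card_Un_le)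
  also have "\<dots> \<le> card ?E + card ?E"
    using fin by (intro add_mono order_trans[OF card_image_le] card_image_le) auto
  finally show ?thesis by simp
qed

text \<open>Serves to add isolated vertices until the vertex set has a prescribed size; the edges,
  and with them the sums and ratios, do not change.\<close>

lemma finite_superset_card_eq:
  assumes "infinite (UNIV :: 'a set)" and "finite (B :: 'a set)" and "card B \<le> N"
  obtains B' where "B \<subseteq> B'" "finite B'" "card B' = N"
proof -
  have "infinite (UNIV - B)"
    using assms by simp
  then obtain D where D: "D \<subseteq> UNIV - B" "finite D" "card D = N - card B"
    using infinite_arbitrarily_large[of "UNIV - B" "N - card B"] by auto
  then have "B \<inter> D = {}" by auto
  then have "card (B \<union> D) = N"
    using assms D by (simp add: card_Un_disjoint)
  then show thesis using assms D by (intro that[of "B \<union> D"]) auto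
qed

section \<open>The generic parameter and the graph it defines\<close>

text \<open>Apart from degenerate coincidences, each condition excludes the root of an equation
  linear in \<open>t\<close>, so finitely many values are to be avoided. The first two conditions
  keep 0 from being an endpoint, the third rules out loops, and the fourth lets an endpoint
  determine \<open>a\<close> and \<open>c\<close>.\<close>

lemma exists_generic_parameter:
  fixes A :: "real set"
  assumes "finite A"
  obtains t where
    "\<forall>c\<in>A - {0}. 1 - t * c \<noteq> 0"
    "\<forall>a\<in>A - {0}. \<forall>b\<in>A. \<forall>c\<in>A - {0}. b + t * (a * c) \<noteq> 0"
    "\<forall>a\<in>A - {0}. \<forall>b\<in>A. \<forall>c\<in>A - {0}. a * (1 - t * c) \<noteq> b + t * (a * c)"
    "inj_on (\<lambda>(a, c). a * (1 - t * c)) ((A - {0}) \<times> (A - {0}))"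
proof -
  let ?A = "A - {0}"
  \<comment> \<open>The four images contain the roots of the four kinds of equations. In the last
    one the denominator may vanish; the quotient is then 0, which merely adds one more excluded
    value.\<close>
  define bad where "bad = (\<lambda>c. 1 / c) ` ?A
    \<union> (\<lambda>(a, b, c). - b / (a * c)) ` (?A \<times> A \<times> ?A)
    \<union> (\<lambda>(a, b, c). (a - b) / (2 * (a * c))) ` (?A \<times> A \<times> ?A)
    \<union> (\<lambda>(a, c, a', c'). (a - a') / (a * c - a' * c')) ` (?A \<times> ?A \<times> ?A \<times> ?A)"
  have "finite bad" unfolding bad_def using assms by auto
  then obtain t where t: "t \<notin> bad"
    using ex_new_if_finite infinite_UNIV_char_0 by blast
  show thesis
  proof
    show "\<forall>c\<in>?A. 1 - t * c \<noteq> 0"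
    proof
      fix c assume c: "c \<in> ?A"
      then have "t \<noteq> 1 / c" using t unfolding bad_def by blast
      then show "1 - t * c \<noteq> 0" using c by (auto simp: field_simps)
    qed
  next
    show "\<forall>a\<in>?A. \<forall>b\<in>A. \<forall>c\<in>?A. b + t * (a * c) \<noteq> 0"
    proof (intro ballI)
      fix a b c assume *: "a \<in> ?A" "b \<in> A" "c \<in> ?A"
      then have "- b / (a * c) \<in> (\<lambda>(a, b, c). - b / (a * c)) ` (?A \<times> A \<times> ?A)"
        by (intro image_eqI[of _ _ "(a, b, c)"]) auto
      then have "t \<noteq> - b / (a * c)" using t unfolding bad_def by blast
      then show "b + t * (a * c) \<noteq> 0" using * by (auto simp: field_simps)
    qed
  next
    show "\<forall>a\<in>?A. \<forall>b\<in>A. \<forall>c\<in>?A. a * (1 - t * c) \<noteq> b + t * (a * c)"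
    proof (intro ballI)
      fix a b c assume *: "a \<in> ?A" "b \<in> A" "c \<in> ?A"
      have "(a - b) / (2 * (a * c)) \<in> (\<lambda>(a, b, c). (a - b) / (2 * (a * c))) ` (?A \<times> A \<times> ?A)"
        using * by (intro image_eqI[of _ _ "(a, b, c)"]) auto
      then have "t \<noteq> (a - b) / (2 * (a * c))" using t unfolding bad_def by blast
      then show "a * (1 - t * c) \<noteq> b + t * (a * c)" using * by (auto simp: field_simps)
    qed
  next
    show "inj_on (\<lambda>(a, c). a * (1 - t * c)) (?A \<times> ?A)"
    proof (rule inj_onI)
      fix p q assume p: "p \<in> ?A \<times> ?A" and q: "q \<in> ?A \<times> ?A"
        and pq_eq: "(\<lambda>(a, c). a * (1 - t * c)) p = (\<lambda>(a, c). a * (1 - t * c)) q"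
      obtain a c a' c' where pq: "p = (a, c)" "q = (a', c')" by force
      have A: "a \<in> A" "c \<in> A" "a' \<in> A" "c' \<in> A" and nz: "a \<noteq> 0" "c \<noteq> 0" "a' \<noteq> 0" "c' \<noteq> 0"
        and eq: "a * (1 - t * c) = a' * (1 - t * c')"
        using p q pq_eq by (auto simp: pq)
      have "(a - a') / (a * c - a' * c') \<in>
          (\<lambda>(a, c, a', c'). (a - a') / (a * c - a' * c')) ` (?A \<times> ?A \<times> ?A \<times> ?A)"
        using A nz by (intro image_eqI[of _ _ "(a, c, a', c')"]) auto
      then have ne: "t \<noteq> (a - a') / (a * c - a' * c')" using t unfolding bad_def by blast
      have eq': "a - a' = t * (a * c - a' * c')" using eq by (simp add: algebra_simps)
      \<comment> \<open>If the products differed, \<open>t\<close> would be the excluded quotient.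
        If they agree, \<open>t\<close> drops out of \<open>eq'\<close> and \<open>a = a'\<close>;
        cancelling this nonzero factor then gives \<open>c = c'\<close>.\<close>
      have "a * c = a' * c'"
      proof (rule ccontr)
        assume "a * c \<noteq> a' * c'"
        then show False using ne eq' by (simp add: eq_divide_eq)
      qed
      moreover from this have "a = a'" using eq' by simp
      ultimately show "p = q" using nz pq by simp
    qed
  qed
qed

text \<open>The combinatorial core, free of exponents. One factor 2 comes from the two orders of the
  endpoints of an edge, the other from the two ratios that an edge contributes.\<close>

lemma exists_sum_ratio_graph:
  fixes A :: "real set"
  assumes fin: "finite A"
  obtains B E where "finite B" "card B \<le> card A ^ 2 + card A * card (A * A)"
    "simple_graph B E" "\<forall>e\<in>E. 0 \<notin> e"
    "card (A - {0}) ^ 2 * card A \<le> 2 * card E"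
    "card (graph_ratio_set E) \<le> 2 * (card (ratio_set A) * card A)"
    "card (graph_sum_set E) \<le> card (A + A)"
proof -
  let ?A = "A - {0}"
  obtain t where t:
    "\<forall>c\<in>?A. 1 - t * c \<noteq> 0"
    "\<forall>a\<in>?A. \<forall>b\<in>A. \<forall>c\<in>?A. b + t * (a * c) \<noteq> 0"
    "\<forall>a\<in>?A. \<forall>b\<in>A. \<forall>c\<in>?A. a * (1 - t * c) \<noteq> b + t * (a * c)"
    "inj_on (\<lambda>(a, c). a * (1 - t * c)) (?A \<times> ?A)"
    using exists_generic_parameter[OF fin] .
  \<comment> \<open>Only \<open>a\<close> and \<open>c\<close> must be nonzero: \<open>a\<close> is
    a denominator, and both are cancelled when the triple is recovered. \<open>b\<close> ranges over
    all of \<open>A\<close>.\<close>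
  define T where "T = ?A \<times> A \<times> ?A"
  define f where "f = (\<lambda>(a, b, c). (a * (1 - t * c), b + t * (a * c)))"
  define E where "E = (\<lambda>(x, y). {x, y}) ` f ` T"
  \<comment> \<open>\<open>X\<close> and \<open>Y\<close> hold the two kinds of endpoints.
    Parametrising \<open>Y\<close> by \<open>b\<close> and the product \<open>p = a * c\<close>,
    rather than by triples, is what brings in |AA|; likewise \<open>R\<close> needs only the ratio
    \<open>r = b / a\<close> and \<open>c\<close>, which brings in |A/A|.\<close>
  define X where "X = (\<lambda>(a, c). a * (1 - t * c)) ` (A \<times> A)"
  define Y where "Y = (\<lambda>(b, p). b + t * p) ` (A \<times> (A * A))"
  define R where "R = (\<lambda>(r, c). (1 - t * c) / (r + t * c)) ` (ratio_set A \<times> A)"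
  have ratio_img: "ratio_set A \<subseteq> (\<lambda>(a, b). a / b) ` (A \<times> A)"
    unfolding ratio_set_def by auto
  have finAA: "finite (A * A)" "finite (A + A)" "finite (ratio_set A)"
    using fin finite_subset[OF ratio_img] by (auto intro: finite_set_times finite_set_plus)
  have edge: "\<exists>a\<in>?A. \<exists>b\<in>A. \<exists>c\<in>?A.
      (u = a * (1 - t * c) \<and> v = b + t * (a * c)) \<or> (v = a * (1 - t * c) \<and> u = b + t * (a * c))"
    if uv: "{u, v} \<in> E" for u v
  proof -
    obtain a b c where "a \<in> ?A" "b \<in> A" "c \<in> ?A"
      and "{u, v} = {a * (1 - t * c), b + t * (a * c)}"
      using uv unfolding E_def T_def f_def by force
    then show ?thesis unfolding doubleton_eq_iff by blast
  qed
  show thesis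
  proof
    show "finite (X \<union> Y)" using fin finAA by (simp add: X_def Y_def)
    have "card X \<le> card (A \<times> A)" "card Y \<le> card (A \<times> (A * A))"
      unfolding X_def Y_def using fin finAA by (intro card_image_le; simp)+
    then show "card (X \<union> Y) \<le> card A ^ 2 + card A * card (A * A)"
      using card_Un_le[of X Y] by (simp add: card_cartesian_product power2_eq_square)
  next
    show "simple_graph (X \<union> Y) E"
      unfolding simple_graph_def
    proof
      fix e assume "e \<in> E"
      then obtain a b c where abc: "a \<in> ?A" "b \<in> A" "c \<in> ?A"
        and e: "e = {a * (1 - t * c), b + t * (a * c)}"
        unfolding E_def T_def f_def by auto
      have "a * (1 - t * c) \<in> X"
        unfolding X_def using abc by (intro image_eqI[of _ _ "(a, c)"]) auto
      moreover have "b + t * (a * c) \<in> Y"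
        unfolding Y_def using abc by (intro image_eqI[of _ _ "(b, a * c)"]) auto
      ultimately show "e \<in> {{u, v} |u v. u \<in> X \<union> Y \<and> v \<in> X \<union> Y \<and> u \<noteq> v}"
        using e t(3) abc by blast
    qed
  next
    show "\<forall>e\<in>E. 0 \<notin> e"
    proof
      fix e assume "e \<in> E"
      then obtain a b c where abc: "a \<in> ?A" "b \<in> A" "c \<in> ?A"
        and e: "e = {a * (1 - t * c), b + t * (a * c)}"
        unfolding E_def T_def f_def by auto
      show "0 \<notin> e" using e abc t(1,2) by auto
    qed
  next
    \<comment> \<open>The first coordinate determines \<open>a\<close> and \<open>c\<close> by the
      choice of \<open>t\<close>; the second then determines \<open>b\<close>.\<close>
    have "inj_on f T"
    proof (rule inj_onI)
      fix p q assume p: "p \<in> T" and q: "q \<in> T" and eq: "f p = f q"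
      obtain a b c a' b' c' where pq: "p = (a, b, c)" "q = (a', b', c')" by (metis prod_cases3)
      have "a * (1 - t * c) = a' * (1 - t * c')" and b: "b + t * (a * c) = b' + t * (a' * c')"
        using eq by (auto simp: f_def pq)
      then have "(a, c) = (a', c')"
        using p q by (intro inj_onD[OF t(4)]) (auto simp: T_def pq)
      then show "p = q" using b pq by simp
    qed
    then have "card (f ` T) = card (?A) ^ 2 * card A"
      by (simp add: card_image T_def card_cartesian_product power2_eq_square)
    moreover have "card (f ` T) \<le> 2 * card E"
      unfolding E_def using fin by (intro card_le_twice_card_unordered_pairs) (auto simp: T_def)
    ultimately show "card ?A ^ 2 * card A \<le> 2 * card E" by simp
  next
    have finR: "finite R" unfolding R_def using fin finAA by simp
    have R: "a * (1 - t * c) / (b + t * (a * c)) \<in> R" if abc: "a \<in> ?A" "b \<in> A" "c \<in> ?A" for a b c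
    proof -
      have "a * (1 - t * c) / (b + t * (a * c)) = (1 - t * c) / (b / a + t * c)"
      proof -
        have "b + t * (a * c) = a * (b / a + t * c)" using abc by (simp add: field_simps)
        then show ?thesis using abc by simp
      qed
      moreover have "b / a \<in> ratio_set A" using abc unfolding ratio_set_def by blast
      ultimately show ?thesis
        unfolding R_def using abc by (intro image_eqI[of _ _ "(b / a, c)"]) auto
    qed
    \<comment> \<open>An edge may be read from either end, and the two readings give reciprocal
      ratios.\<close>
    have "graph_ratio_set E \<subseteq> R \<union> inverse ` R"
    proof
      fix r assume "r \<in> graph_ratio_set E"
      then obtain u v where r: "r = u / v" "{u, v} \<in> E" unfolding graph_ratio_set_def by blast
      have "u / v = inverse (v / u)" by simp
      then show "r \<in> R \<union> inverse ` R" using edge[OF r(2)] R r(1) by blast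
    qed
    then have "card (graph_ratio_set E) \<le> card (R \<union> inverse ` R)"
      using finR by (intro card_mono) auto
    also have "\<dots> \<le> card R + card (inverse ` R)" by (rule card_Un_le)
    also have "\<dots> \<le> 2 * card R" using card_image_le[OF finR, of inverse] by simp
    also have "card R \<le> card (ratio_set A \<times> A)"
      unfolding R_def using fin finAA by (intro card_image_le) simp
    finally show "card (graph_ratio_set E) \<le> 2 * (card (ratio_set A) * card A)"
      by (simp add: card_cartesian_product)
  next
    have "graph_sum_set E \<subseteq> A + A"
    proof
      fix s assume "s \<in> graph_sum_set E"
      then obtain u v where s: "s = u + v" "{u, v} \<in> E" unfolding graph_sum_set_def by blast
      obtain a b c where "a \<in> A" "b \<in> A"
        and "s = a * (1 - t * c) + (b + t * (a * c))"
        using edge[OF s(2)] s(1) by (metis DiffD1 add.commute)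
      moreover from this have "s = a + b" by (simp add: algebra_simps)
      ultimately show "s \<in> A + A" by auto
    qed
    then show "card (graph_sum_set E) \<le> card (A + A)"
      using finAA by (intro card_mono)
  qed
qed

section \<open>Bounded n: graphs with a single edge\<close>

lemma exists_single_edge_graph:
  assumes "N \<ge> 2"
  obtains B :: "real set" and E where "finite B" "card B = N" "simple_graph B E" "\<forall>e\<in>E. 0 \<notin> e"
    "card E = 1" "card (graph_ratio_set E) \<le> 2" "card (graph_sum_set E) \<le> 1"
proof -
  have "card {1, 2 :: real} \<le> N" using assms by simp
  then obtain B where B: "{1, 2 :: real} \<subseteq> B" "finite B" "card B = N"
    using finite_superset_card_eq[OF infinite_UNIV_char_0, of "{1, 2 :: real}" N]
    by (metis finite.emptyI finite.insertI)
  let ?E = "{{1, 2 :: real}}"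
  have "graph_ratio_set ?E \<subseteq> {1/2, 2}"
    unfolding graph_ratio_set_def by (auto simp: doubleton_eq_iff)
  then have "card (graph_ratio_set ?E) \<le> card {1/2, 2 :: real}" by (intro card_mono) auto
  moreover have "graph_sum_set ?E \<subseteq> {3}"
    unfolding graph_sum_set_def by (auto simp: doubleton_eq_iff)
  then have "card (graph_sum_set ?E) \<le> card {3 :: real}" by (intro card_mono) auto
  moreover have "simple_graph B ?E"
    unfolding simple_graph_def
    using B(1) by (intro subsetI CollectI exI[of _ 1] exI[of _ 2]) simp
  ultimately show thesis using B by (intro that[of B ?E]) auto
qed

text \<open>Multiplication by a fixed nonzero element of \<open>A\<close> embeds \<open>A\<close>
  into \<open>A * A\<close>. If there is no such element, the left side is 0.\<close>

lemma card_minus_one_le_card_set_times: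
  fixes A :: "real set"
  assumes "finite A"
  shows "card A - 1 \<le> card (A * A)"
proof (cases "A - {0} = {}")
  case True
  then have "card A \<le> card {0 :: real}" by (intro card_mono) auto
  then show ?thesis by simp
next
  case False
  then obtain a where a: "a \<in> A" "a \<noteq> 0" by blast
  have "card A = card ((*) a ` A)"
    using a by (intro card_image[symmetric]) (auto simp: inj_on_def)
  also have "\<dots> \<le> card (A * A)"
    using assms a by (intro card_mono finite_set_times) auto
  finally show ?thesis by simp
qed

text \<open>One single-edge graph serves all \<open>n \<le> n0\<close>, since the constants may
  depend on \<open>n0\<close>. Nothing is assumed about the exponents: they may be negative, and at
  \<beta> = 3 division by zero makes them 0.\<close>

lemma bounded_size_case:
  fixes \<alpha> \<beta> :: real and n0 :: nat
  obtains c C' where "c > 0" "C' > 0"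
    "\<forall>n \<le> n0. \<exists>(N :: nat) (B :: real set) (E :: real set set).
              finite B \<and> card B = N \<and> N > n \<and>
              simple_graph B E \<and> (\<forall>e \<in> E. 0 \<notin> e) \<and>
              real (card E) \<ge> c * real N powr (3 / (3 - \<beta>)) \<and>
              real (card (graph_ratio_set E)) \<le> C' * real N \<and>
              real (card (graph_sum_set E)) \<le> C' * real N powr ((2 - \<alpha>) / (3 - \<beta>))"
proof -
  \<comment> \<open>\<open>N\<close> exceeds every \<open>n \<le> n0\<close> and leaves room for two
    endpoints. \<open>c\<close> makes the required number of edges exactly 1. In \<open>C'\<close>,
    the entry 1 gives \<open>C' * N \<ge> 2\<close> for the two ratios, and the other entry makes
    the bound on sums at least 1 even for a negative exponent.\<close>
  define N where "N = n0 + 2"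
  define c where "c = real N powr (- (3 / (3 - \<beta>)))"
  define C' where "C' = max 1 (real N powr (- ((2 - \<alpha>) / (3 - \<beta>))))"
  have N: "N \<ge> 2" by (simp add: N_def)
  obtain B E where BE: "finite B" "card B = N" "simple_graph B E" "\<forall>e\<in>E. 0 \<notin> e"
    "card E = 1" "card (graph_ratio_set E) \<le> 2" "card (graph_sum_set E) \<le> 1"
    using exists_single_edge_graph[OF N] .
  have "c > 0" "C' > 0" using N by (auto simp: c_def C'_def)
  have 1: "c * real N powr (3 / (3 - \<beta>)) = 1"
    using N unfolding c_def by (simp flip: powr_add)
  have "1 * real N \<le> C' * real N" by (intro mult_right_mono) (auto simp: C'_def)
  then have 2: "2 \<le> C' * real N" using N by linarith
  have "1 = real N powr (- ((2 - \<alpha>) / (3 - \<beta>))) * real N powr ((2 - \<alpha>) / (3 - \<beta>))"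
    using N by (simp flip: powr_add)
  also have "\<dots> \<le> C' * real N powr ((2 - \<alpha>) / (3 - \<beta>))"
    by (intro mult_right_mono) (auto simp: C'_def)
  finally have 3: "1 \<le> C' * real N powr ((2 - \<alpha>) / (3 - \<beta>))" .
  show thesis
  proof (rule that[OF \<open>c > 0\<close> \<open>C' > 0\<close>], intro allI impI)
    fix n assume "n \<le> n0"
    then have "N > n" by (simp add: N_def)
    moreover have "real (card (graph_ratio_set E)) \<le> C' * real N" using BE(6) 2 by linarith
    moreover have "real (card (graph_sum_set E)) \<le> C' * real N powr ((2 - \<alpha>) / (3 - \<beta>))"
      using BE(7) 3 by linarith
    ultimately show "\<exists>(N :: nat) (B :: real set) (E :: real set set).
              finite B \<and> card B = N \<and> N > n \<and>
              simple_graph B E \<and> (\<forall>e \<in> E. 0 \<notin> e) \<and>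
              real (card E) \<ge> c * real N powr (3 / (3 - \<beta>)) \<and>
              real (card (graph_ratio_set E)) \<le> C' * real N \<and>
              real (card (graph_sum_set E)) \<le> C' * real N powr ((2 - \<alpha>) / (3 - \<beta>))"
      using BE(1-5) 1 by (intro exI[of _ N] exI[of _ B] exI[of _ E]) simp
  qed
qed

section \<open>Exponents of the graph for \<beta> \<le> 1 and n \<ge> 2\<close>

text \<open>Since \<beta> \<le> 1 gives \<open>d \<ge> 2\<close>, the term n^2 is at most n^d, so (C
  + 1) n^d vertices suffice. With N of order n^d, the n^3 edges become N^(3/d), the ratios number at
  most 2 n n^(2-\<beta>) = 2 n^d, and n^(2-\<alpha>) is the power (2-\<alpha>)/d of n^d.\<close>

lemma large_size_case:
  fixes \<alpha> \<beta> C :: real and A :: "real set"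
  defines "d \<equiv> 3 - \<beta>"
  assumes \<beta>: "0 < \<beta>" "\<beta> \<le> 1" and C: "C \<ge> 1"
    and A: "finite A" "card A = n" and n: "n \<ge> 2"
    and sum: "real (card (A + A)) \<le> real n powr (2 - \<alpha>)"
    and prod: "real (card (A * A)) \<le> C * real n powr (2 - \<beta>)"
    and ratio: "real (card (ratio_set A)) \<le> real n powr (2 - \<beta>)"
  obtains N B E where "finite B" "card B = N" "N > n" "simple_graph B E" "\<forall>e\<in>E. 0 \<notin> e"
    "real (card E) \<ge> (C + 2) powr (- (3 / d)) / 8 * real N powr (3 / d)"
    "real (card (graph_ratio_set E)) \<le> 2 * real N"
    "real (card (graph_sum_set E)) \<le> real N powr ((2 - \<alpha>) / d)"
proof -
  have d: "d \<ge> 2" "d > 0" using \<beta> by (auto simp: d_def)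
  obtain B0 E where BE: "finite B0" "card B0 \<le> n ^ 2 + n * card (A * A)"
    "simple_graph B0 E" "\<forall>e\<in>E. 0 \<notin> e"
    "card (A - {0}) ^ 2 * n \<le> 2 * card E"
    "card (graph_ratio_set E) \<le> 2 * (card (ratio_set A) * n)"
    "card (graph_sum_set E) \<le> card (A + A)"
    using exists_sum_ratio_graph[OF A(1)] unfolding A(2) .
  \<comment> \<open>This gives n^d \<le> N \<le> (C + 2) n^d, the rounding being absorbed by another
    n^d. The lower bound serves the ratios and sums, the upper bound the edges.\<close>
  define N where "N = nat \<lceil>(C + 1) * real n powr d\<rceil>"
  have nd: "real n powr d = real n * real n powr (2 - \<beta>)"
    using n powr_add[of "real n" 1 "2 - \<beta>"] by (simp add: d_def)
  have sq: "real n ^ 2 \<le> real n powr d"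
    using n d powr_mono[of 2 d "real n"] by (simp add: powr_numeral)
  have nn: "2 * real n \<le> real n ^ 2" using n by (simp add: power2_eq_square)
  have "(C + 1) * real n powr d \<ge> 2 * real n powr d"
    using C by (intro mult_right_mono) auto
  then have lowN: "real n powr d \<le> real N" "real n < real N"
    and N1: "(C + 1) * real n powr d \<le> real N"
    using sq nn n real_nat_ceiling_ge[of "(C + 1) * real n powr d"]
    unfolding N_def[symmetric] by linarith+
  have "(C + 1) * real n powr d \<ge> 0" using C by simp
  then have "real N \<le> (C + 1) * real n powr d + 1" unfolding N_def by linarith
  also have "\<dots> \<le> (C + 2) * real n powr d"
    using sq nn n by (simp add: algebra_simps)
  finally have upN: "real N \<le> (C + 2) * real n powr d" .
  have "real (card B0) \<le> real (n ^ 2 + n * card (A * A))"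
    using BE(2) by (simp only: of_nat_le_iff)
  also have "\<dots> = real n ^ 2 + real n * real (card (A * A))" by simp
  also have "\<dots> \<le> real n powr d + real n * (C * real n powr (2 - \<beta>))"
    using sq prod by (intro add_mono mult_left_mono) auto
  also have "\<dots> = (C + 1) * real n powr d" by (simp add: nd algebra_simps)
  finally have "card B0 \<le> N" using N1 by linarith
  from finite_superset_card_eq[OF infinite_UNIV_char_0 BE(1) this]
  obtain B where B: "B0 \<subseteq> B" "finite B" "card B = N" .
  show thesis
  proof
    show "finite B" "card B = N" by fact+
    show "N > n" using lowN by simp
    show "simple_graph B E" using BE(3) B(1) unfolding simple_graph_def by blast
    show "\<forall>e\<in>E. 0 \<notin> e" by fact
  next
    \<comment> \<open>The power of \<open>C + 2\<close> in the edge constant cancels the one coming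
      from \<open>upN\<close>. The 8 is 2 from unordered pairs times 4 from squaring
      \<open>card (A - {0}) \<ge> n - 1 \<ge> n / 2\<close>.\<close>
    have "real N powr (3 / d) \<le> ((C + 2) * real n powr d) powr (3 / d)"
      using upN d by (intro powr_mono2) auto
    also have "\<dots> = (C + 2) powr (3 / d) * real n ^ 3"
      using C n d by (simp add: powr_mult powr_powr powr_numeral)
    finally have "(C + 2) powr (- (3 / d)) / 8 * real N powr (3 / d)
        \<le> (C + 2) powr (- (3 / d)) / 8 * ((C + 2) powr (3 / d) * real n ^ 3)"
      by (intro mult_left_mono) auto
    also have "\<dots> = ((C + 2) powr (- (3 / d)) * (C + 2) powr (3 / d)) * real n ^ 3 / 8" by simp
    also have "(C + 2) powr (- (3 / d)) * (C + 2) powr (3 / d) = 1"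
      using C by (simp flip: powr_add)
    also have "1 * real n ^ 3 / 8 = (real n / 2) ^ 2 * real n / 2"
      by (simp add: power2_eq_square power3_eq_cube)
    also have "\<dots> \<le> real (card (A - {0})) ^ 2 * real n / 2"
    proof -
      have "n - 1 \<le> card (A - {0})" using A by (simp add: card_Diff_singleton_if)
      then have "real n / 2 \<le> real (card (A - {0}))" using n by linarith
      then show ?thesis by (intro divide_right_mono mult_right_mono power_mono) auto
    qed
    also have "\<dots> = real (card (A - {0}) ^ 2 * n) / 2" by simp
    also have "\<dots> \<le> real (card E)" using BE(5) by linarith
    finally show "(C + 2) powr (- (3 / d)) / 8 * real N powr (3 / d) \<le> real (card E)" .
  next
    have "real (card (graph_ratio_set E)) \<le> real (2 * (card (ratio_set A) * n))"
      using BE(6) by (simp only: of_nat_le_iff)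
    also have "\<dots> = 2 * (real (card (ratio_set A)) * real n)" by simp
    also have "\<dots> \<le> 2 * (real n powr (2 - \<beta>) * real n)"
      using ratio by (intro mult_left_mono mult_right_mono) auto
    also have "\<dots> \<le> 2 * real N" using lowN(1) nd by (simp add: mult.commute)
    finally show "real (card (graph_ratio_set E)) \<le> 2 * real N" .
  next
    \<comment> \<open>Passing from n^d to N in the bound on sums needs a nonnegative exponent. A
      nonempty sumset forces 1 \<le> n^(2-\<alpha>), and as n > 1 this yields \<alpha> \<le>
      2.\<close>
    have "A \<noteq> {}" using A n by auto
    then have "A + A \<noteq> {}" by (auto simp: set_plus_def)
    then have "1 \<le> real (card (A + A))"
      using A(1) by (simp add: Suc_le_eq card_gt_0_iff finite_set_plus)
    then have "1 \<le> real n powr (2 - \<alpha>)" using sum by linarith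
    then have \<alpha>: "2 - \<alpha> \<ge> 0"
      using n powr_less_mono[of "2 - \<alpha>" 0 "real n"] by fastforce
    have "real (card (graph_sum_set E)) \<le> real n powr (2 - \<alpha>)" using BE(7) sum by linarith
    also have "\<dots> = (real n powr d) powr ((2 - \<alpha>) / d)" using d by (simp add: powr_powr)
    also have "\<dots> \<le> real N powr ((2 - \<alpha>) / d)"
      using lowN(1) \<alpha> d by (intro powr_mono2) auto
    finally show "real (card (graph_sum_set E)) \<le> real N powr ((2 - \<alpha>) / d)" .
  qed
qed

section \<open>The case distinction at \<beta> = 1 and the choice of constants\<close>

theorem theorem3p1:
  fixes \<alpha> \<beta> C :: real
  assumes "\<alpha> > 0" and "\<beta> > 0" and "C \<ge> 1"
  shows "\<exists>c > 0. \<exists>C' > 0. \<forall>(n :: nat) (A :: real set).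
           finite A \<longrightarrow> card A = n \<longrightarrow>
           real (card (A + A)) \<le> real n powr (2 - \<alpha>) \<longrightarrow>
           inverse C * real n powr (2 - \<beta>) \<le> real (card (A * A)) \<longrightarrow>
           real (card (A * A)) \<le> C * real n powr (2 - \<beta>) \<longrightarrow>
           real (card (ratio_set A)) \<le> real n powr (2 - \<beta>) \<longrightarrow>
           (\<exists>(N :: nat) (B :: real set) (E :: real set set).
              finite B \<and> card B = N \<and> N > n \<and>
              simple_graph B E \<and> (\<forall>e \<in> E. 0 \<notin> e) \<and>
              real (card E) \<ge> c * real N powr (3 / (3 - \<beta>)) \<and>
              real (card (graph_ratio_set E)) \<le> C' * real N \<and>
              real (card (graph_sum_set E)) \<le> C' * real N powr ((2 - \<alpha>) / (3 - \<beta>)))"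
proof (cases "\<beta> > 1")
  case True
  \<comment> \<open>For n \<ge> 2, n/2 \<le> n - 1 \<le> |AA| \<le> C n^(2-\<beta>) gives
    n^(\<beta>-1) \<le> 2C, and \<beta> > 1 allows taking the root. The added 1 covers sets with at
    most one element.\<close>
  define n0 where "n0 = nat \<lceil>(2 * C) powr (1 / (\<beta> - 1))\<rceil> + 1"
  have bound: "card A \<le> n0"
    if A: "finite A" and prod: "real (card (A * A)) \<le> C * real (card A) powr (2 - \<beta>)"
    for A :: "real set"
  proof (cases "card A \<ge> 2")
    case False
    then show ?thesis by (simp add: n0_def)
  next
    case n: True
    let ?n = "real (card A)"
    have "?n / 2 \<le> real (card (A * A))"
      using card_minus_one_le_card_set_times[OF A] n by linarith
    then have "?n * ?n powr (\<beta> - 2) \<le> 2 * (C * ?n powr (2 - \<beta>)) * ?n powr (\<beta> - 2)"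
      using prod by (intro mult_right_mono) auto
    also have "\<dots> = 2 * C * (?n powr (2 - \<beta>) * ?n powr (\<beta> - 2))" by simp
    also have "\<dots> = 2 * C" using n by (simp flip: powr_add)
    also have "?n * ?n powr (\<beta> - 2) = ?n powr (\<beta> - 1)"
      using n powr_add[of ?n 1 "\<beta> - 2"] by simp
    finally have "(?n powr (\<beta> - 1)) powr (1 / (\<beta> - 1)) \<le> (2 * C) powr (1 / (\<beta> - 1))"
      using True by (intro powr_mono2) auto
    then have "?n \<le> (2 * C) powr (1 / (\<beta> - 1))" using True n by (simp add: powr_powr)
    then show ?thesis unfolding n0_def by linarith
  qed
  obtain c C' where c: "c > 0" "C' > 0"
    and small: "\<forall>n \<le> n0. \<exists>(N :: nat) (B :: real set) (E :: real set set).
              finite B \<and> card B = N \<and> N > n \<and>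
              simple_graph B E \<and> (\<forall>e \<in> E. 0 \<notin> e) \<and>
              real (card E) \<ge> c * real N powr (3 / (3 - \<beta>)) \<and>
              real (card (graph_ratio_set E)) \<le> C' * real N \<and>
              real (card (graph_sum_set E)) \<le> C' * real N powr ((2 - \<alpha>) / (3 - \<beta>))"
    using bounded_size_case[of n0 \<beta> \<alpha>] .
  show ?thesis
  proof (rule exI[of _ c], rule conjI[OF c(1)], rule exI[of _ C'], rule conjI[OF c(2)],
      intro allI impI, goal_cases)
    case (1 n A)
    then show ?case using bound by (intro small[rule_format]) blast
  qed
next
  case False
  \<comment> \<open>Sizes \<open>n \<le> 1\<close> are split off, since the construction yields no
    edge for \<open>A = {0}\<close>.\<close>
  obtain c C' where c: "c > 0" "C' > 0"
    and small: "\<forall>n \<le> 1. \<exists>(N :: nat) (B :: real set) (E :: real set set).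
              finite B \<and> card B = N \<and> N > n \<and>
              simple_graph B E \<and> (\<forall>e \<in> E. 0 \<notin> e) \<and>
              real (card E) \<ge> c * real N powr (3 / (3 - \<beta>)) \<and>
              real (card (graph_ratio_set E)) \<le> C' * real N \<and>
              real (card (graph_sum_set E)) \<le> C' * real N powr ((2 - \<alpha>) / (3 - \<beta>))"
    using bounded_size_case[of 1 \<beta> \<alpha>] .
  \<comment> \<open>\<open>c1\<close> is the edge constant for \<open>n \<ge> 2\<close>, where 2
    bounds the other two constants. The minimum and the maximum then serve both ranges of
    \<open>n\<close>.\<close>
  define c1 where "c1 = (C + 2) powr (- (3 / (3 - \<beta>))) / 8"
  define c2 where "c2 = min c c1"
  define C2 where "C2 = max C' 2"
  have c2: "c2 > 0" "C2 > 0" using c \<open>C \<ge> 1\<close> by (auto simp: c2_def c1_def C2_def)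
  have c2_le: "c2 * x \<le> c * x" "c2 * x \<le> c1 * x" "C' * x \<le> C2 * x" "2 * x \<le> C2 * x" "x \<le> C2 * x"
    if "x \<ge> 0" for x
    using that mult_right_mono[of 1 C2 x]
    by (auto intro!: mult_right_mono simp: c2_def C2_def)
  show ?thesis
  proof (rule exI[of _ c2], rule conjI[OF c2(1)], rule exI[of _ C2], rule conjI[OF c2(2)],
      intro allI impI, goal_cases)
    case (1 n A)
    show ?case
    proof (cases "n \<le> 1")
      case True
      obtain N B E where "finite B" "card B = N" "N > n" "simple_graph B E" "\<forall>e\<in>E. 0 \<notin> e"
        and *: "real (card E) \<ge> c * real N powr (3 / (3 - \<beta>))"
        "real (card (graph_ratio_set E)) \<le> C' * real N"
        "real (card (graph_sum_set E)) \<le> C' * real N powr ((2 - \<alpha>) / (3 - \<beta>))"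
        using small[rule_format, OF True] by blast
      then show ?thesis
        using order_trans[OF c2_le(1) *(1)] order_trans[OF *(2) c2_le(3)]
          order_trans[OF *(3) c2_le(3)]
        by (intro exI[of _ N] exI[of _ B] exI[of _ E]) simp
    next
      case n: False
      have "\<beta> \<le> 1" "n \<ge> 2" using False n by auto
      obtain N B E where "finite B" "card B = N" "N > n" "simple_graph B E" "\<forall>e\<in>E. 0 \<notin> e"
        and *: "real (card E) \<ge> c1 * real N powr (3 / (3 - \<beta>))"
        "real (card (graph_ratio_set E)) \<le> 2 * real N"
        "real (card (graph_sum_set E)) \<le> real N powr ((2 - \<alpha>) / (3 - \<beta>))"
        using large_size_case[OF \<open>\<beta> > 0\<close> \<open>\<beta> \<le> 1\<close> \<open>C \<ge> 1\<close> 1(1,2) \<open>n \<ge> 2\<close> 1(3,5,6)]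
        unfolding c1_def .
      then show ?thesis
        using order_trans[OF c2_le(2) *(1)] order_trans[OF *(2) c2_le(4)]
          order_trans[OF *(3) c2_le(5)]
        by (intro exI[of _ N] exI[of _ B] exI[of _ E]) simp
    qed
  qed
qed

end
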